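(* Let $\xi$ and $\eta$ be independent real random variables, both with regular distributions (possibly of different degrees). Suppose that their polar coordinates, i.e. the radius $\rho=\sqrt{\xi^2+\eta^2}$ and the polar angle $\theta$ of the point $(\xi,\eta)$, are also independent. Then both $\xi$ and $\eta$ have quasi-centered quasi-Gaussian distributions with the same quasi-standard: there exist $\sigma>0$, $\alpha=(\alpha(1),\alpha(2))$ and $\beta=(\beta(1),\beta(2))$ with $\alpha(1),\alpha(2),\beta(1),\beta(2)>-1$, and constants $C_1,C_2,C_3,C_4\ge 0$ such that $$\mathrm{Law}(\xi)=QN(0,\alpha,\sigma,C_1,C_2),\qquad \mathrm{Law}(\eta)=QN(0,\beta,\sigma,C_3,C_4).$$
   Context: Regular distribution: the distribution of a real random variable $\xi$ is called regular (at the origin) if it has a density $f$ with respect to Lebesgue measure on $\mathbb{R}$ for which there exists a real constant $\mu$ (called the degree; necessarily $\mu>-1$) such that $$0<\inf_{x\in(-1,1)\setminus\{0\}}\frac{f(x)}{|x|^{\mu}}\le\sup_{x\in(-1,1)\setminus\{0\}}\frac{f(x)}{|x|^{\mu}}<\infty .$$ No continuity or global strict positivity of the density is assumed. Polar coordinates: for the random point $(\xi,\eta)\in\mathbb{R}^2\setminus\{(0,0)\}$ (almost surely), $\rho=\sqrt{\xi^2+\eta^2}$ and $\theta\in[0,2\pi)$ is the angle with $\xi=\rho\cos\theta$, $\eta=\rho\sin\theta$. Quasi-Gaussian distribution: for $\sigma>0$ let $f_\sigma(x)=(2\pi)^{-1/2}\sigma^{-1}\exp(-x^2/(2\sigma^2))$,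 $x\in\mathbb{R}$. For $\alpha=(\alpha(1),\alpha(2))$ with $\alpha(1),\alpha(2)>-1$ and constants $C_1,C_2\ge 0$ let $$\omega_\alpha(x;C_1,C_2)=C_1|x|^{\alpha(1)}I_{(-\infty,0)}(x)+C_2x^{\alpha(2)}I_{(0,\infty)}(x),\qquad g_{\alpha,\sigma}(x;C_1,C_2)=\omega_\alpha(x;C_1,C_2)\,f_\sigma(x),$$ where $I_A$ is the indicator function of $A$, and $C_1,C_2$ are such that $g_{\alpha,\sigma}(\cdot;C_1,C_2)$ is a probability density, that is, $$C_1I_{\alpha(1)}(\sigma)+C_2I_{\alpha(2)}(\sigma)=\sigma(2\pi)^{1/2},\qquad I_{\alpha(k)}(\sigma)=\int_0^\infty x^{\alpha(k)}e^{-x^2/(2\sigma^2)}\,dx .$$ For $a\in\mathbb{R}$, one writes $\mathrm{Law}(\xi)=QN(a,\alpha,\sigma,C_1,C_2)$ if $\xi$ has density $x\mapsto g_{\alpha,\sigma}(x-a;C_1,C_2)$. Such a distribution is called quasi-Gaussian, with quasi-center $a$ and quasi-standard $\sigma$; it is quasi-centered if $a=0$. *)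

theory Defs
  imports "HOL-Probability.Probability"
begin

text \<open>The infimum and the supremum are taken in the extended reals, so that
  finiteness of the supremum really expresses boundedness.\<close>

definition regular_degree :: "(real \<Rightarrow> real) \<Rightarrow> real \<Rightarrow> bool" where
  "regular_degree f \<mu> \<longleftrightarrow>
     0 < (INF x\<in>{-1<..<1} - {0}. ereal (f x / \<bar>x\<bar> powr \<mu>)) \<and>
     (SUP x\<in>{-1<..<1} - {0}. ereal (f x / \<bar>x\<bar> powr \<mu>)) < \<infinity>"

definition regular_distribution :: "'a measure \<Rightarrow> ('a \<Rightarrow> real) \<Rightarrow> bool" where
  "regular_distribution M X \<longleftrightarrow>
     (\<exists>f \<mu>. (\<forall>x. 0 \<le> f x) \<and> distributed M lborel X (\<lambda>x. ennreal (f x)) \<and>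
        regular_degree f \<mu>)"

definition qg_weight :: "real \<times> real \<Rightarrow> real \<Rightarrow> real \<Rightarrow> real \<Rightarrow> real" where
  "qg_weight \<alpha> C1 C2 x =
     C1 * \<bar>x\<bar> powr fst \<alpha> * indicator {..<0} x + C2 * x powr snd \<alpha> * indicator {0<..} x"

definition qg_density :: "real \<times> real \<Rightarrow> real \<Rightarrow> real \<Rightarrow> real \<Rightarrow> real \<Rightarrow> real" where
  "qg_density \<alpha> \<sigma> C1 C2 x = qg_weight \<alpha> C1 C2 x * normal_density 0 \<sigma> x"

definition qg_integral :: "real \<Rightarrow> real \<Rightarrow> real" where
  "qg_integral p \<sigma> = (LBINT x:{0<..}. x powr p * exp (- x\<^sup>2 / (2 * \<sigma>\<^sup>2)))"

definition qg_admissible :: "real \<times> real \<Rightarrow> real \<Rightarrow> real \<Rightarrow> real \<Rightarrow> bool" where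
  "qg_admissible \<alpha> \<sigma> C1 C2 \<longleftrightarrow>
     \<sigma> > 0 \<and> fst \<alpha> > -1 \<and> snd \<alpha> > -1 \<and> C1 \<ge> 0 \<and> C2 \<ge> 0 \<and>
     C1 * qg_integral (fst \<alpha>) \<sigma> + C2 * qg_integral (snd \<alpha>) \<sigma> = \<sigma> * sqrt (2 * pi)"

text \<open>\<open>has_law_QN M X a \<alpha> \<sigma> C1 C2\<close> renders \<open>Law(X) = QN(a, \<alpha>, \<sigma>, C1, C2)\<close>, including
  the requirement that the parameters are those of a probability density.\<close>

definition has_law_QN ::
  "'a measure \<Rightarrow> ('a \<Rightarrow> real) \<Rightarrow> real \<Rightarrow> real \<times> real \<Rightarrow> real \<Rightarrow> real \<Rightarrow> real \<Rightarrow> bool" where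
  "has_law_QN M X a \<alpha> \<sigma> C1 C2 \<longleftrightarrow>
     qg_admissible \<alpha> \<sigma> C1 C2 \<and>
     distributed M lborel X (\<lambda>x. ennreal (qg_density \<alpha> \<sigma> C1 C2 (x - a)))"

end

theory Submission
  imports Defs
begin

text \<open>This is a variant of Lukacs' characterization of the Gamma law. For a choice of signs
  \<open>e, e'\<close> put \<open>F\<^sub>j(s) = E(\<xi>\<^sup>2\<^sup>j exp(-s \<xi>\<^sup>2); e \<xi> > 0)\<close> and
  \<open>G\<^sub>k(s) = E(\<eta>\<^sup>2\<^sup>k exp(-s \<eta>\<^sup>2); e' \<eta> > 0)\<close>. By the two independence assumptions
  \<open>F\<^sub>j G\<^sub>k\<close> is a constant depending on \<open>j, k\<close> times a function of \<open>s\<close> depending on \<open>j + k\<close> only.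
  Hence \<open>F\<^sub>0 G\<^sub>1 = r F\<^sub>1 G\<^sub>0\<close> and \<open>F\<^sub>0 F\<^sub>2 = K F\<^sub>1\<^sup>2\<close> with constants \<open>r > 0\<close> and, by strict
  Cauchy--Schwarz, \<open>K > 1\<close>. As \<open>F\<^sub>j' = -F\<^sub>j\<^sub>+\<^sub>1\<close>, the second relation says that \<open>F\<^sub>0/F\<^sub>1\<close> is affine
  with slope \<open>K - 1\<close>, so \<open>F\<^sub>0\<close> is a multiple of \<open>(\<gamma>/(\<gamma> + s))\<^sup>p\<close>; the first relation carries the
  rate \<open>\<gamma>\<close> over to the other sides. These transforms determine the law. Regularity only serves to
  exclude atoms and to give every half-line positive probability.\<close>

subsection \<open>One-sided Laplace transforms of the squared variable\<close>

text \<open>The sign \<open>e\<close> is \<open>1\<close> or \<open>- 1\<close> and selects a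
  half-line; the index \<open>k\<close> counts derivatives up to sign. The open half-line leaves out
  the origin, also for \<open>k = 0\<close>.\<close>

definition half_laplace :: "real measure \<Rightarrow> real \<Rightarrow> nat \<Rightarrow> real \<Rightarrow> real" where
  "half_laplace M e k s = (LINT x|M. indicator {0<..} (e * x) * (x\<^sup>2) ^ k * exp (- s * x\<^sup>2))"

text \<open>One term of the exponential series is at most its sum. This bounds every integrand of
  \<open>half_laplace\<close>, whatever the moments of the law.\<close>

lemma power_mult_exp_le:
  fixes x s :: real
  assumes "0 \<le> x" "0 < s"
  shows "x ^ k * exp (- s * x) \<le> fact k / s ^ k"
proof -
  have "(\<Sum>n\<in>{k}. (s * x) ^ n /\<^sub>R fact n) \<le> exp (s * x)"
    unfolding exp_def by (intro sum_le_suminf summable_exp_generic) (use assms in auto)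
  hence "(s * x) ^ k \<le> fact k * exp (s * x)"
    by (simp add: field_simps)
  thus ?thesis
    using assms by (simp add: exp_minus field_simps power_mult_distrib)
qed

text \<open>Second-order Taylor remainder, where half of the decay rate absorbs
  \<open>exp \<bar>h * x\<bar>\<close>. The remaining factor \<open>exp (- (s / 2) * x)\<close>
  keeps the bound integrable.\<close>

lemma exp_diff_bound:
  fixes h x s :: real
  assumes "0 \<le> x" "0 < s" "\<bar>h\<bar> \<le> s / 2"
  shows "\<bar>exp (- (s + h) * x) - exp (- s * x) + h * x * exp (- s * x)\<bar>
           \<le> h\<^sup>2 * x\<^sup>2 * exp (- (s / 2) * x)"
proof -
  have "\<bar>exp (- h * x) - (1 - h * x)\<bar> \<le> exp \<bar>h * x\<bar> * \<bar>h * x\<bar> ^ 2"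
    using Taylor_exp_field[of "- h * x" 1] by (simp add: power2_eq_square abs_mult)
  also have "\<dots> \<le> exp (s / 2 * x) * (h\<^sup>2 * x\<^sup>2)"
  proof (rule mult_mono)
    have "\<bar>h * x\<bar> \<le> s / 2 * x"
      unfolding abs_mult using assms by (intro mult_mono) auto
    thus "exp \<bar>h * x\<bar> \<le> exp (s / 2 * x)" by simp
  qed (auto simp: power_mult_distrib)
  finally have "exp (- s * x) * \<bar>exp (- h * x) - (1 - h * x)\<bar>
      \<le> exp (- s * x) * (exp (s / 2 * x) * (h\<^sup>2 * x\<^sup>2))"
    by (intro mult_left_mono) auto
  also have "\<dots> = (exp (- s * x) * exp (s / 2 * x)) * (h\<^sup>2 * x\<^sup>2)"
    by simp
  also have "exp (- s * x) * exp (s / 2 * x) = exp (- (s / 2) * x)"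
    unfolding exp_add[symmetric] by (rule arg_cong[where f=exp]) (simp add: field_simps)
  finally have bound: "\<bar>exp (- s * x) * (exp (- h * x) - (1 - h * x))\<bar>
      \<le> exp (- (s / 2) * x) * (h\<^sup>2 * x\<^sup>2)"
    by (simp only: abs_mult abs_exp_cancel)
  have exp_sum: "exp (- (s + h) * x) = exp (- s * x) * exp (- h * x)"
    unfolding exp_add[symmetric] by (rule arg_cong[where f=exp]) (simp add: algebra_simps)
  have "exp (- s * x) * (exp (- h * x) - (1 - h * x))
      = exp (- (s + h) * x) - exp (- s * x) + h * x * exp (- s * x)"
    by (simp only: right_diff_distrib mult_1_right exp_sum) (simp add: mult_ac)
  with bound show ?thesis
    by (simp add: mult_ac)
qed

lemma (in real_distribution) half_laplace_integrable:
  assumes "0 < s"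
  shows "integrable M (\<lambda>x. indicator {0<..} (e * x) * (x\<^sup>2) ^ k * exp (- s * x\<^sup>2))"
proof (rule integrable_const_bound[where B = "fact k / s ^ k"])
  show "AE x in M. norm (indicator {0<..} (e * x) * (x\<^sup>2) ^ k * exp (- s * x\<^sup>2)) \<le> fact k / s ^ k"
    using power_mult_exp_le[of "x\<^sup>2" s k for x] assms
    by (intro AE_I2) (auto simp: indicator_def abs_mult)
qed simp

text \<open>Differentiation under the integral sign by an explicit estimate: the error of the
  difference quotient is at most \<open>\<bar>h\<bar>\<close> times the transform of index
  \<open>k + 2\<close> at \<open>s / 2\<close>.\<close>

lemma (in real_distribution) half_laplace_has_derivative:
  assumes s: "0 < s"
  shows "(half_laplace M e k has_real_derivative - half_laplace M e (Suc k) s) (at s)"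
proof -
  define L where "L = half_laplace M e"
  have "\<bar>(L k (s + h) - L k s) / h - (- L (Suc k) s)\<bar> \<le> \<bar>h\<bar> * L (Suc (Suc k)) (s / 2)"
    if h: "h \<noteq> 0" "\<bar>h\<bar> < s / 2" for h
  proof -
    let ?w = "\<lambda>x::real. indicator {0<..} (e * x) * (x\<^sup>2) ^ k :: real"
    have pos: "0 < s + h" using h by (auto simp: abs_if split: if_splits)
    note int = half_laplace_integrable[of _ e]
    have diff: "L k (s + h) - L k s + h * L (Suc k) s
      = (LINT x|M. indicator {0<..} (e * x) * (x\<^sup>2) ^ k * exp (- (s + h) * x\<^sup>2)
           - indicator {0<..} (e * x) * (x\<^sup>2) ^ k * exp (- s * x\<^sup>2)
           + h * (indicator {0<..} (e * x) * (x\<^sup>2) ^ Suc k * exp (- s * x\<^sup>2)))"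
      unfolding L_def half_laplace_def
      by (simp only: integral_mult_right_zero
            Bochner_Integration.integral_diff[OF int[OF pos, of k] int[OF s, of k]]
            Bochner_Integration.integral_add[OF Bochner_Integration.integrable_diff
              [OF int[OF pos, of k] int[OF s, of k]] integrable_mult_right[OF int[OF s, of "Suc k"]]])
    have "\<bar>L k (s + h) - L k s + h * L (Suc k) s\<bar> \<le> (LINT x|M. h\<^sup>2 *
        (indicator {0<..} (e * x) * (x\<^sup>2) ^ Suc (Suc k) * exp (- (s / 2) * x\<^sup>2)))"
      unfolding diff
    proof (rule integral_abs_bound[THEN order_trans], rule integral_mono)
      fix x :: real
      have "\<bar>?w x * (exp (- (s + h) * x\<^sup>2) - exp (- s * x\<^sup>2) + h * x\<^sup>2 * exp (- s * x\<^sup>2))\<bar>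
          \<le> ?w x * (h\<^sup>2 * (x\<^sup>2)\<^sup>2 * exp (- (s / 2) * x\<^sup>2))"
        unfolding abs_mult using exp_diff_bound[of "x\<^sup>2" s h] s h
        by (intro mult_mono) auto
      thus "\<bar>indicator {0<..} (e * x) * (x\<^sup>2) ^ k * exp (- (s + h) * x\<^sup>2)
           - indicator {0<..} (e * x) * (x\<^sup>2) ^ k * exp (- s * x\<^sup>2)
           + h * (indicator {0<..} (e * x) * (x\<^sup>2) ^ Suc k * exp (- s * x\<^sup>2))\<bar>
          \<le> h\<^sup>2 * (indicator {0<..} (e * x) * (x\<^sup>2) ^ Suc (Suc k) * exp (- (s / 2) * x\<^sup>2))"
        by (simp add: algebra_simps power2_eq_square)
    next
      show "integrable M (\<lambda>x. \<bar>indicator {0<..} (e * x) * (x\<^sup>2) ^ k * exp (- (s + h) * x\<^sup>2)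
           - indicator {0<..} (e * x) * (x\<^sup>2) ^ k * exp (- s * x\<^sup>2)
           + h * (indicator {0<..} (e * x) * (x\<^sup>2) ^ Suc k * exp (- s * x\<^sup>2))\<bar>)"
        by (rule integrable_abs[OF Bochner_Integration.integrable_add[OF
              Bochner_Integration.integrable_diff[OF int[OF pos] int[OF s]]
              integrable_mult_right[OF int[OF s]]]])
      show "integrable M (\<lambda>x. h\<^sup>2 *
          (indicator {0<..} (e * x) * (x\<^sup>2) ^ Suc (Suc k) * exp (- (s / 2) * x\<^sup>2)))"
        by (rule integrable_mult_right[OF int]) (use s in simp)
    qed
    also have "\<dots> = h\<^sup>2 * L (Suc (Suc k)) (s / 2)"
      unfolding L_def half_laplace_def by (simp only: integral_mult_right_zero)
    finally have *: "\<bar>L k (s + h) - L k s + h * L (Suc k) s\<bar> \<le> h\<^sup>2 * L (Suc (Suc k)) (s / 2)" .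
    have quot: "(L k (s + h) - L k s) / h - (- L (Suc k) s) = (L k (s + h) - L k s + h * L (Suc k) s) / h"
      using h by (simp add: field_simps)
    have "\<bar>(L k (s + h) - L k s) / h - (- L (Suc k) s)\<bar> = \<bar>L k (s + h) - L k s + h * L (Suc k) s\<bar> / \<bar>h\<bar>"
      unfolding quot by simp
    also have "\<dots> \<le> h\<^sup>2 * L (Suc (Suc k)) (s / 2) / \<bar>h\<bar>"
      using * by (rule divide_right_mono) simp
    also have "\<dots> = \<bar>h\<bar> * L (Suc (Suc k)) (s / 2)"
      using h by (cases "0 < h") (auto simp: power2_eq_square)
    finally show ?thesis .
  qed
  hence "eventually (\<lambda>h. norm ((L k (s + h) - L k s) / h - (- L (Suc k) s))
      \<le> \<bar>h\<bar> * L (Suc (Suc k)) (s / 2)) (at 0)"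
    unfolding eventually_at using s by (intro exI[of _ "s / 2"]) (auto simp: dist_real_def)
  moreover have "(\<lambda>h. \<bar>h\<bar> * L (Suc (Suc k)) (s / 2)) \<midarrow>0\<rightarrow> 0"
    by (auto intro!: tendsto_eq_intros)
  ultimately have "(\<lambda>h. (L k (s + h) - L k s) / h - (- L (Suc k) s)) \<midarrow>0\<rightarrow> 0"
    by (rule Lim_null_comparison)
  thus ?thesis
    unfolding DERIV_def L_def by (simp only: LIM_zero_iff)
qed

text \<open>Dominated convergence. It recovers the mass of the half-line from arguments
  \<open>s > 0\<close>, to which the differential relations are confined.\<close>

lemma (in real_distribution) half_laplace_tendsto_at_0:
  "(\<lambda>n. half_laplace M e 0 (1 / Suc n)) \<longlonglongrightarrow> prob {x. 0 < e * x}"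
proof -
  have "(\<lambda>n. half_laplace M e 0 (1 / Suc n)) \<longlonglongrightarrow> (LINT x|M. indicator {0<..} (e * x))"
    unfolding half_laplace_def
  proof (rule integral_dominated_convergence[where w = "\<lambda>_. 1"])
    have "(\<lambda>n. 1 / real (Suc n)) \<longlonglongrightarrow> 0"
      by (rule LIMSEQ_Suc[OF lim_1_over_n])
    hence "(\<lambda>n. indicator {0<..} (e * x) * (x\<^sup>2) ^ 0 * exp (- (1 / real (Suc n)) * x\<^sup>2))
        \<longlonglongrightarrow> indicator {0<..} (e * x) * (x\<^sup>2) ^ 0 * exp (- 0 * x\<^sup>2)" for x :: real
      by (intro tendsto_intros)
    thus "AE x in M. (\<lambda>n. indicator {0<..} (e * x) * (x\<^sup>2) ^ 0 * exp (- (1 / real (Suc n)) * x\<^sup>2))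
        \<longlonglongrightarrow> indicator {0<..} (e * x)"
      by simp
  qed (auto simp: indicator_def)
  also have "(LINT x|M. indicator {0<..} (e * x)) = (LINT x|M. indicator {x. 0 < e * x} x)"
    by (simp add: indicator_def)
  also have "\<dots> = prob {x. 0 < e * x}"
    by simp
  finally show ?thesis .
qed

lemma (in real_distribution) half_laplace_pos:
  assumes s: "0 < s" and e: "\<not> (AE x in M. \<not> 0 < e * x)"
  shows "0 < half_laplace M e k s"
proof -
  have "half_laplace M e k s \<noteq> 0"
  proof
    assume "half_laplace M e k s = 0"
    hence "AE x in M. indicator {0<..} (e * x) * (x\<^sup>2) ^ k * exp (- s * x\<^sup>2) = 0"
      unfolding half_laplace_def
      by (subst (asm) integral_nonneg_eq_0_iff_AE[OF half_laplace_integrable[OF s]]) auto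
    hence "AE x in M. \<not> 0 < e * x"
      by eventually_elim (auto simp: indicator_def split: if_splits)
    with e show False ..
  qed
  moreover have "0 \<le> half_laplace M e k s"
    unfolding half_laplace_def by (rule integral_nonneg_AE) simp
  ultimately show ?thesis by simp
qed

text \<open>Cauchy--Schwarz is strict because, without atoms, the squared variable is not almost surely constant.\<close>

lemma (in real_distribution) half_laplace_strict_log_convex:
  assumes s: "0 < s" and e: "\<not> (AE x in M. \<not> 0 < e * x)"
    and no_atoms: "\<And>y. AE x in M. x \<noteq> y"
  shows "(half_laplace M e 1 s)\<^sup>2 < half_laplace M e 0 s * half_laplace M e 2 s"
proof -
  define L where "L k = half_laplace M e k s" for k
  \<comment> \<open>\<open>q\<close> is the mean of \<open>x\<^sup>2\<close> under the measure
    weighted by the indicator and the exponential, so \<open>?g\<close> integrates to an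
    unnormalized variance.\<close>
  define q where "q = L 1 / L 0"
  let ?f = "\<lambda>k x. indicator {0<..} (e * x) * (x\<^sup>2) ^ k * exp (- s * x\<^sup>2) :: real"
  let ?g = "\<lambda>x. indicator {0<..} (e * x) * (x\<^sup>2 - q)\<^sup>2 * exp (- s * x\<^sup>2) :: real"
  have g: "?g = (\<lambda>x. ?f 2 x - 2 * q * ?f 1 x + q\<^sup>2 * ?f 0 x)"
    by (auto simp: algebra_simps power2_eq_square fun_eq_iff)
  note int = half_laplace_integrable[OF s]
  have int_g: "integrable M ?g"
    unfolding g by (intro Bochner_Integration.integrable_add Bochner_Integration.integrable_diff
                      integrable_mult_right int)
  have "integral\<^sup>L M ?g \<noteq> 0"
  proof
    assume "integral\<^sup>L M ?g = 0"
    hence "AE x in M. ?g x = 0"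
      by (subst (asm) integral_nonneg_eq_0_iff_AE[OF int_g]) auto
    moreover have "AE x in M. x \<noteq> sqrt q" "AE x in M. x \<noteq> - sqrt q"
      by (rule no_atoms)+
    ultimately have "AE x in M. \<not> 0 < e * x"
    proof eventually_elim
      case (elim x)
      have "x\<^sup>2 \<noteq> q"
      proof
        assume "x\<^sup>2 = q"
        hence "sqrt q = \<bar>x\<bar>" by auto
        with elim show False by (auto simp: abs_if split: if_splits)
      qed
      with elim show ?case by (auto simp: indicator_def split: if_splits)
    qed
    with e show False ..
  qed
  moreover have "0 \<le> integral\<^sup>L M ?g"
    by (rule integral_nonneg_AE) simp
  moreover have "integral\<^sup>L M ?g = L 2 - 2 * q * L 1 + q\<^sup>2 * L 0"
    unfolding g L_def half_laplace_def
    by (simp only: integral_mult_right_zero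
          Bochner_Integration.integral_diff[OF int[of e 2] integrable_mult_right[OF int[of e 1]]]
          Bochner_Integration.integral_add[OF Bochner_Integration.integrable_diff
            [OF int[of e 2] integrable_mult_right[OF int[of e 1]]] integrable_mult_right[OF int[of e 0]]])
  moreover have L0: "0 < L 0"
    unfolding L_def by (rule half_laplace_pos[OF s e])
  ultimately have "0 < (L 2 - 2 * q * L 1 + q\<^sup>2 * L 0) * L 0"
    by (metis mult_pos_pos order_le_less)
  also have "\<dots> = L 0 * L 2 - (L 1)\<^sup>2"
    unfolding q_def using L0 by (simp add: field_simps power2_eq_square)
  finally show ?thesis unfolding L_def by simp
qed

subsection \<open>Characterization of Gamma-type transforms\<close>

text \<open>By the quotient rule \<open>eq\<close> gives \<open>f0 / f1\<close> the derivative
  \<open>K - 1\<close>, which \<open>lt\<close> makes positive. Then the logarithmic derivative of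
  \<open>f0\<close> is \<open>- 1 / (\<kappa> * s + d)\<close>, which integrates to a Gamma
  transform of rate \<open>d / \<kappa>\<close> and shape \<open>1 / \<kappa>\<close>.\<close>

lemma gamma_transform_of_ode:
  fixes f0 f1 f2 :: "real \<Rightarrow> real"
  assumes pos: "\<And>s. 0 < s \<Longrightarrow> 0 < f0 s" "\<And>s. 0 < s \<Longrightarrow> 0 < f1 s"
    and d0: "\<And>s. 0 < s \<Longrightarrow> (f0 has_real_derivative - f1 s) (at s)"
    and d1: "\<And>s. 0 < s \<Longrightarrow> (f1 has_real_derivative - f2 s) (at s)"
    and eq: "\<And>s. 0 < s \<Longrightarrow> f0 s * f2 s = K * (f1 s)\<^sup>2"
    and lt: "\<And>s. 0 < s \<Longrightarrow> (f1 s)\<^sup>2 < f0 s * f2 s"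
    and lim: "(\<lambda>n. f0 (1 / Suc n)) \<longlonglongrightarrow> P"
  shows "\<exists>\<gamma> p. 0 < \<gamma> \<and> 0 < p \<and> (\<forall>s>0. f0 s = P * (\<gamma> / (\<gamma> + s)) powr p)"
proof -
  define \<kappa> where "\<kappa> = K - 1"
  have \<kappa>: "0 < \<kappa>"
    using eq[of 1] lt[of 1] pos(2)[of 1] by (simp add: \<kappa>_def)
  have "\<exists>d. \<forall>s\<in>{0<..}. f0 s / f1 s - \<kappa> * s = d"
  proof (rule has_field_derivative_zero_constant)
    fix s :: real assume "s \<in> {0<..}"
    hence s: "0 < s" by simp
    have "((\<lambda>s. f0 s / f1 s - \<kappa> * s) has_real_derivative
        ((- f1 s * f1 s - f0 s * - f2 s) / (f1 s * f1 s) - \<kappa>)) (at s)"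
      using pos(2)[OF s] by (auto intro!: derivative_eq_intros d0[OF s] d1[OF s])
    also have "(- f1 s * f1 s - f0 s * - f2 s) / (f1 s * f1 s) - \<kappa> = 0"
      using pos(2)[OF s] eq[OF s] by (simp add: \<kappa>_def field_simps power2_eq_square)
    finally show "((\<lambda>s. f0 s / f1 s - \<kappa> * s) has_real_derivative 0) (at s within {0<..})"
      by (rule has_field_derivative_at_within)
  qed simp
  then obtain d where d: "f0 s / f1 s = \<kappa> * s + d" if "0 < s" for s
    by (force simp: algebra_simps)
  have lin_pos: "0 < \<kappa> * s + d" if "0 < s" for s
    using d[OF that] pos[OF that] by (metis divide_pos_pos)
  have inv: "(\<lambda>n. 1 / real (Suc n)) \<longlonglongrightarrow> 0"
    by (rule LIMSEQ_Suc[OF lim_1_over_n])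
  have lin_lim: "(\<lambda>n. \<kappa> * (1 / real (Suc n)) + d) \<longlonglongrightarrow> d"
    by (rule tendsto_eq_intros inv refl | simp)+
  have lin_pos_seq: "0 < \<kappa> * (1 / real (Suc n)) + d" for n
    by (rule lin_pos) simp
  have "0 \<le> d"
  proof (rule LIMSEQ_le_const[OF lin_lim], intro exI allI impI)
    fix n show "0 \<le> \<kappa> * (1 / real (Suc n)) + d"
      by (rule less_imp_le[OF lin_pos_seq])
  qed
  have "\<exists>c. \<forall>s\<in>{0<..}. ln (f0 s) + 1 / \<kappa> * ln (\<kappa> * s + d) = c"
  proof (rule has_field_derivative_zero_constant)
    fix s :: real assume "s \<in> {0<..}"
    hence s: "0 < s" by simp
    have "((\<lambda>s. ln (f0 s) + 1 / \<kappa> * ln (\<kappa> * s + d)) has_real_derivative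
        (- f1 s / f0 s + 1 / \<kappa> * (\<kappa> / (\<kappa> * s + d)))) (at s)"
      using pos(1)[OF s] lin_pos[OF s] by (auto intro!: derivative_eq_intros d0[OF s])
    also have "- f1 s / f0 s + 1 / \<kappa> * (\<kappa> / (\<kappa> * s + d)) = 0"
      using pos[OF s] \<kappa> by (simp add: d[OF s, symmetric])
    finally show "((\<lambda>s. ln (f0 s) + 1 / \<kappa> * ln (\<kappa> * s + d)) has_real_derivative 0) (at s within {0<..})"
      by (rule has_field_derivative_at_within)
  qed simp
  then obtain c where c: "ln (f0 s) + 1 / \<kappa> * ln (\<kappa> * s + d) = c" if "0 < s" for s
    by auto
  have prod: "f0 s * (\<kappa> * s + d) powr (1 / \<kappa>) = exp c" if "0 < s" for s
    using c[OF that] pos(1)[OF that] lin_pos[OF that] by (simp add: powr_def exp_add flip: c[OF that])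
  \<comment> \<open>\<open>d = 0\<close> is not yet excluded, so the power converges because its
    exponent is positive and its base nonnegative.\<close>
  have "(\<lambda>n. f0 (1 / Suc n) * (\<kappa> * (1 / Suc n) + d) powr (1 / \<kappa>)) \<longlonglongrightarrow> P * d powr (1 / \<kappa>)"
    using \<kappa> less_imp_le[OF lin_pos_seq]
    by (intro tendsto_mult lim tendsto_powr'[OF lin_lim tendsto_const] disjI2 conjI
          always_eventually allI) simp_all
  hence "(\<lambda>n::nat. exp c) \<longlonglongrightarrow> P * d powr (1 / \<kappa>)"
    by (subst (asm) prod) simp_all
  hence P: "P * d powr (1 / \<kappa>) = exp c"
    by (simp add: LIMSEQ_const_iff)
  \<comment> \<open>A pole of \<open>f0\<close> at the origin is incompatible with a finite limit:
    for \<open>d = 0\<close> the product would be \<open>0\<close>, but \<open>exp c\<close> is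
    positive.\<close>
  hence "d \<noteq> 0" by (intro notI) simp
  with \<open>0 \<le> d\<close> have "0 < d" by simp
  have "f0 s = P * (d / \<kappa> / (d / \<kappa> + s)) powr (1 / \<kappa>)" if s: "0 < s" for s
  proof -
    have "f0 s = exp c / (\<kappa> * s + d) powr (1 / \<kappa>)"
      using prod[OF s] lin_pos[OF s] by (simp add: field_simps)
    also have "\<dots> = P * (d / (\<kappa> * s + d)) powr (1 / \<kappa>)"
      using lin_pos[OF s] \<open>0 < d\<close> by (simp add: P[symmetric] powr_divide)
    also have "d / (\<kappa> * s + d) = d / \<kappa> / (d / \<kappa> + s)"
      using \<kappa> lin_pos[OF s] by (simp add: field_simps)
    finally show ?thesis .
  qed
  thus ?thesis
    using \<kappa> \<open>0 < d\<close> by (intro exI[of _ "d / \<kappa>"] exI[of _ "1 / \<kappa>"]) auto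
qed

text \<open>\<open>eq\<close> says that the logarithmic derivative of \<open>g0\<close> is
  \<open>k\<close> times that of \<open>f0\<close>. Hence \<open>g0\<close> is a multiple of
  \<open>f0 powr k\<close>: the rate survives, the shape becomes \<open>p * k\<close>, and
  \<open>lim\<close> identifies the factor.\<close>

lemma gamma_transform_transfer:
  fixes f0 f1 g0 g1 :: "real \<Rightarrow> real"
  assumes pos: "\<And>s. 0 < s \<Longrightarrow> 0 < f0 s" "\<And>s. 0 < s \<Longrightarrow> 0 < g0 s"
    and df: "\<And>s. 0 < s \<Longrightarrow> (f0 has_real_derivative - f1 s) (at s)"
    and dg: "\<And>s. 0 < s \<Longrightarrow> (g0 has_real_derivative - g1 s) (at s)"
    and eq: "\<And>s. 0 < s \<Longrightarrow> f0 s * g1 s = k * f1 s * g0 s"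
    and f0: "\<And>s. 0 < s \<Longrightarrow> f0 s = P * (\<gamma> / (\<gamma> + s)) powr p"
    and par: "0 < \<gamma>" "0 < p" "0 < k"
    and lim: "(\<lambda>n. g0 (1 / Suc n)) \<longlonglongrightarrow> Q"
  shows "\<exists>q>0. \<forall>s>0. g0 s = Q * (\<gamma> / (\<gamma> + s)) powr q"
proof -
  have "0 < P"
    using pos(1)[of 1] par by (simp add: f0 zero_less_mult_iff)
  have "\<exists>c. \<forall>s\<in>{0<..}. ln (g0 s) - k * ln (f0 s) = c"
  proof (rule has_field_derivative_zero_constant)
    fix s :: real assume "s \<in> {0<..}"
    hence s: "0 < s" by simp
    have "((\<lambda>s. ln (g0 s) - k * ln (f0 s)) has_real_derivative
        (- g1 s / g0 s - k * (- f1 s / f0 s))) (at s)"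
      using pos[OF s] by (auto intro!: derivative_eq_intros df[OF s] dg[OF s])
    also have "- g1 s / g0 s - k * (- f1 s / f0 s) = 0"
      using pos[OF s] eq[OF s] by (simp add: field_simps)
    finally show "((\<lambda>s. ln (g0 s) - k * ln (f0 s)) has_real_derivative 0) (at s within {0<..})"
      by (rule has_field_derivative_at_within)
  qed simp
  then obtain c where c: "ln (g0 s) - k * ln (f0 s) = c" if "0 < s" for s
    by auto
  define C where "C = exp c * P powr k"
  have g0: "g0 s = C * (\<gamma> / (\<gamma> + s)) powr (p * k)" if s: "0 < s" for s
  proof -
    have "g0 s = exp (ln (g0 s))" using pos(2)[OF s] by simp
    also have "ln (g0 s) = c + k * ln (f0 s)" using c[OF s] by simp
    also have "exp (c + k * ln (f0 s)) = exp c * f0 s powr k"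
      using pos(1)[OF s] by (simp add: exp_add powr_def)
    also have "f0 s powr k = P powr k * (\<gamma> / (\<gamma> + s)) powr (p * k)"
      unfolding f0[OF s] using \<open>0 < P\<close> by (simp add: powr_mult powr_powr)
    finally show ?thesis by (simp add: C_def)
  qed
  have inv: "(\<lambda>n. 1 / real (Suc n)) \<longlonglongrightarrow> 0"
    by (rule LIMSEQ_Suc[OF lim_1_over_n])
  have "(\<lambda>n. C * (\<gamma> / (\<gamma> + 1 / real (Suc n))) powr (p * k))
      \<longlonglongrightarrow> C * (\<gamma> / (\<gamma> + 0)) powr (p * k)"
    using par by (intro tendsto_mult tendsto_powr' tendsto_divide tendsto_add tendsto_const inv) auto
  hence "(\<lambda>n. g0 (1 / Suc n)) \<longlonglongrightarrow> C"
    using par by (simp add: g0 del: of_nat_Suc)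
  hence "Q = C" using lim by (rule LIMSEQ_unique[rotated])
  with g0 par show ?thesis by (intro exI[of _ "p * k"]) auto
qed

subsection \<open>Uniqueness\<close>

text \<open>A bounded Borel injection of the line. The exponential alone would lose the side of
  \<open>x\<close>, so the sign is put back.\<close>

definition signed_gauss :: "real \<Rightarrow> real" where
  "signed_gauss x = sgn x * exp (- x\<^sup>2)"

lemma borel_measurable_signed_gauss [measurable]: "signed_gauss \<in> borel_measurable borel"
  unfolding signed_gauss_def[abs_def] sgn_real_def by measurable

lemma abs_signed_gauss_le: "\<bar>signed_gauss x\<bar> \<le> 1"
  by (auto simp: signed_gauss_def abs_mult abs_sgn_eq)

text \<open>Also true at the origin, where \<open>sgn 0 = 0\<close> cancels the root. A left inverse
  defined everywhere lets an equality of image measures be undone.\<close>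

lemma signed_gauss_inverse:
  "sgn (signed_gauss x) * sqrt (- ln \<bar>signed_gauss x\<bar>) = x"
  by (auto simp: signed_gauss_def sgn_mult abs_mult abs_sgn_eq sgn_mult_abs)

text \<open>The exponent \<open>0\<close> is excluded since both indicators vanish at the origin but
  \<open>0 ^ 0 = 1\<close>. The factors \<open>1 * x\<close> and \<open>(x\<^sup>2) ^ 0\<close>
  reproduce the integrand of \<open>half_laplace\<close> literally.\<close>

lemma signed_gauss_power:
  assumes "0 < n"
  shows "signed_gauss x ^ n = indicator {0<..} (1 * x) * (x\<^sup>2) ^ 0 * exp (- real n * x\<^sup>2)
    + (- 1) ^ n * (indicator {0<..} (- 1 * x) * (x\<^sup>2) ^ 0 * exp (- real n * x\<^sup>2))"
  using assms
  by (auto simp: signed_gauss_def power_mult_distrib sgn_if exp_of_nat_mult[symmetric])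

lemma (in real_distribution) expectation_signed_gauss_power:
  "expectation (\<lambda>x. signed_gauss x ^ n) =
     (if n = 0 then 1 else half_laplace M 1 0 n + (- 1) ^ n * half_laplace M (- 1) 0 n)"
proof (cases "n = 0")
  case False
  hence n: "0 < real n" by simp
  show ?thesis
    using False unfolding half_laplace_def
    by (simp only: signed_gauss_power if_False
          Bochner_Integration.integral_add[OF half_laplace_integrable[OF n, of 1 0]
            integrable_mult_right[OF half_laplace_integrable[OF n, of "- 1" 0]]]
          integral_mult_right_zero)
qed (simp add: prob_space[simplified])

text \<open>All absolute moments are at most \<open>1\<close>, so the Taylor error tends to
  \<open>0\<close> for every \<open>t\<close> as \<open>n\<close> grows.\<close>

lemma (in real_distribution) char_signed_gauss_approx:
  "cmod (char (distr M borel signed_gauss) t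
      - (\<Sum>k\<le>n. (\<i> * t) ^ k / fact k * expectation (\<lambda>x. signed_gauss x ^ k)))
    \<le> 2 * \<bar>t\<bar> ^ n / fact n"
proof -
  have le: "\<bar>signed_gauss x\<bar> ^ k \<le> 1" for x k
    by (intro power_le_one abs_signed_gauss_le) simp
  have int: "integrable M (\<lambda>x. signed_gauss x ^ k)" for k
    using le by (intro integrable_const_bound[where B = 1]) (auto simp: power_abs)
  have "cmod (char (distr M borel signed_gauss) t
      - (\<Sum>k\<le>n. (\<i> * t) ^ k / fact k * expectation (\<lambda>x. signed_gauss x ^ k)))
    \<le> 2 * \<bar>t\<bar> ^ n / fact n * expectation (\<lambda>x. \<bar>signed_gauss x\<bar> ^ n)"
    by (rule char_approx1'[OF int _ refl]) simp
  also have "\<dots> \<le> 2 * \<bar>t\<bar> ^ n / fact n * expectation (\<lambda>x. 1)"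
    using int le by (intro mult_left_mono integral_mono) (auto simp flip: power_abs)
  finally show ?thesis
    by (simp add: prob_space[simplified])
qed

text \<open>The variable \<open>sgn x * exp (- x\<^sup>2)\<close> is bounded, hence determined by its moments, and these are
  the values of the two one-sided transforms at the positive integers.\<close>

lemma real_distribution_eqI_half_laplace:
  assumes "real_distribution M" "real_distribution N"
    and eq: "\<And>e s. e \<in> {1, - 1} \<Longrightarrow> 0 < s \<Longrightarrow> half_laplace M e 0 s = half_laplace N e 0 s"
  shows "M = N"
proof -
  interpret M: real_distribution M by fact
  interpret N: real_distribution N by fact
  have mom: "M.expectation (\<lambda>x. signed_gauss x ^ k) = N.expectation (\<lambda>x. signed_gauss x ^ k)" for k
    by (simp add: M.expectation_signed_gauss_power N.expectation_signed_gauss_power eq)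
  have "char (distr M borel signed_gauss) t = char (distr N borel signed_gauss) t" for t
  proof -
    \<comment> \<open>By \<open>mom\<close> both characteristic functions are within the same error
      of one polynomial.\<close>
    have "cmod (char (distr M borel signed_gauss) t - char (distr N borel signed_gauss) t)
        \<le> 4 * (\<bar>t\<bar> ^ n /\<^sub>R fact n)" for n
      using norm_diff_triangle_le[OF M.char_signed_gauss_approx[of t n]
          N.char_signed_gauss_approx[of t n, unfolded norm_minus_commute[of "char _ _"],
            folded mom]]
      by (simp add: divide_inverse)
    moreover have "(\<lambda>n. 4 * (\<bar>t\<bar> ^ n /\<^sub>R fact n)) \<longlonglongrightarrow> 4 * 0"
      by (intro tendsto_mult_left summable_LIMSEQ_zero summable_exp_generic)
    ultimately show ?thesis
      by (metis (no_types, lifting) LIMSEQ_le_const mult_zero_right norm_le_zero_iff right_minus_eq)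
  qed
  hence "distr M borel signed_gauss = distr N borel signed_gauss"
    by (intro Levy_uniqueness M.real_distribution_distr N.real_distribution_distr) auto
  \<comment> \<open>Levy uniqueness identifies the images under \<open>signed_gauss\<close>; its
    left inverse carries the equality back to \<open>M\<close> and \<open>N\<close>.\<close>
  hence "distr (distr M borel signed_gauss) borel (\<lambda>u. sgn u * sqrt (- ln \<bar>u\<bar>))
      = distr (distr N borel signed_gauss) borel (\<lambda>u. sgn u * sqrt (- ln \<bar>u\<bar>))"
    by simp
  moreover have "(\<lambda>u::real. sgn u * sqrt (- ln \<bar>u\<bar>)) \<in> borel_measurable borel"
    unfolding sgn_real_def by measurable
  ultimately have "distr M borel (\<lambda>x. x) = distr N borel (\<lambda>x. x)"
    by (simp add: distr_distr comp_def signed_gauss_inverse)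
  thus ?thesis
    by (simp add: distr_id2)
qed

subsection \<open>Transforms of quasi-Gaussian laws\<close>

text \<open>One side of a quasi-Gaussian density up to a constant, with \<open>c\<close> in the role
  of \<open>1 / (2 * \<sigma>\<^sup>2)\<close>.\<close>

definition power_gauss :: "real \<Rightarrow> real \<Rightarrow> real \<Rightarrow> real" where
  "power_gauss a c x = indicator {0<..} x * (x powr a * exp (- c * x\<^sup>2))"

lemma borel_measurable_power_gauss [measurable]: "power_gauss a c \<in> borel_measurable borel"
  unfolding power_gauss_def[abs_def] by measurable

lemma power_gauss_nonneg: "0 \<le> power_gauss a c x"
  by (simp add: power_gauss_def)

text \<open>On \<open>(0, 1]\<close> the power is integrable because \<open>a > - 1\<close>; beyond
  \<open>1\<close> it is at most \<open>x ^ n\<close>, and the Gaussian law has all absolute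
  moments.\<close>

lemma integrable_power_gauss_1:
  assumes "- 1 < a"
  shows "integrable lborel (power_gauss a 1)"
proof -
  define n where "n = nat \<lceil>a\<rceil>"
  have "(\<lambda>x. x powr a) absolutely_integrable_on {0..1}"
    using assms by (intro nonnegative_absolutely_integrable_1 integrable_on_powr_from_0) auto
  hence 1: "integrable lborel (\<lambda>x. indicator {0..1} x * x powr a)"
    unfolding set_integrable_def by (subst (asm) integrable_completion) auto
  \<comment> \<open>The standard deviation \<open>1 / sqrt 2\<close> makes the normal density equal
    to \<open>exp (- x\<^sup>2) / sqrt pi\<close>.\<close>
  have "integrable lborel (\<lambda>x. sqrt pi * (normal_density 0 (1 / sqrt 2) x * \<bar>x\<bar> ^ n))"
    using integrable_normal_moment_abs[of "1 / sqrt 2" 0 n] by simp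
  also have "(\<lambda>x. sqrt pi * (normal_density 0 (1 / sqrt 2) x * \<bar>x\<bar> ^ n)) = (\<lambda>x. \<bar>x\<bar> ^ n * exp (- x\<^sup>2))"
    by (auto simp: normal_density_def power_divide)
  finally have 2: "integrable lborel (\<lambda>x. \<bar>x\<bar> ^ n * exp (- x\<^sup>2) :: real)" .
  show ?thesis
  proof (rule Bochner_Integration.integrable_bound[OF Bochner_Integration.integrable_add[OF 1 2]])
    show "AE x in lborel. norm (power_gauss a 1 x)
        \<le> norm (indicator {0..1} x * x powr a + \<bar>x\<bar> ^ n * exp (- x\<^sup>2))"
    proof (rule AE_I2)
      fix x :: real
      consider "x \<le> 0" | "0 < x" "x \<le> 1" | "1 < x" by linarith
      thus "norm (power_gauss a 1 x) \<le> norm (indicator {0..1} x * x powr a + \<bar>x\<bar> ^ n * exp (- x\<^sup>2))"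
      proof cases
        case 2
        have "x powr a * exp (- x\<^sup>2) \<le> x powr a"
          by (rule mult_right_le_one_le) auto
        also have "\<dots> \<le> x powr a + x ^ n * exp (- x\<^sup>2)"
          using 2 by simp
        finally show ?thesis
          using 2 by (simp add: power_gauss_def)
      next
        case 3
        have "x powr a \<le> x powr real n"
          using 3 by (intro powr_mono) (auto simp: n_def, linarith)
        thus ?thesis
          using 3 by (simp add: power_gauss_def powr_realpow)
      qed (simp add: power_gauss_def)
    qed
  qed simp
qed

lemma power_gauss_scale:
  assumes "0 < c"
  shows "power_gauss a c (0 + 1 / sqrt c * x) = c powr (- a / 2) * power_gauss a 1 x"
proof (cases "0 < x")
  case True
  have "(x / sqrt c) powr a = c powr (- a / 2) * x powr a"
    using assms True by (simp add: powr_divide powr_half_sqrt[symmetric] powr_powr powr_minus field_simps)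
  thus ?thesis
    using assms True by (simp add: power_gauss_def power_divide)
qed (use assms in \<open>simp add: power_gauss_def zero_less_divide_iff\<close>)

lemma integrable_power_gauss:
  assumes "- 1 < a" "0 < c"
  shows "integrable lborel (power_gauss a c)"
proof -
  have "integrable lborel (\<lambda>x. power_gauss a c (0 + 1 / sqrt c * x))"
    unfolding power_gauss_scale[OF assms(2)]
    by (intro integrable_mult_right integrable_power_gauss_1 assms)
  thus ?thesis
    using assms by (subst (asm) lborel_integrable_real_affine_iff) auto
qed

lemma integral_power_gauss_scale:
  assumes "0 < c"
  shows "integral\<^sup>L lborel (power_gauss a c)
    = c powr (- (a + 1) / 2) * integral\<^sup>L lborel (power_gauss a 1)"
proof -
  have "integral\<^sup>L lborel (power_gauss a c)
      = \<bar>1 / sqrt c\<bar> *\<^sub>R (LINT x|lborel. power_gauss a c (0 + 1 / sqrt c * x))"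
    using assms by (intro lborel_integral_real_affine) simp
  also have "\<dots> = 1 / sqrt c * c powr (- a / 2) * integral\<^sup>L lborel (power_gauss a 1)"
    using assms by (simp only: power_gauss_scale integral_mult_right_zero) simp
  also have "1 / sqrt c = c powr (- 1 / 2)"
    using assms by (simp add: powr_half_sqrt powr_minus_divide)
  also have "c powr (- 1 / 2) * c powr (- a / 2) = c powr (- (a + 1) / 2)"
    unfolding powr_add[symmetric] by (rule arg_cong[where f = "(powr) c"]) (simp add: field_simps)
  finally show ?thesis .
qed

lemma integral_power_gauss_pos:
  assumes "- 1 < a" "0 < c"
  shows "0 < integral\<^sup>L lborel (power_gauss a c)"
proof -
  have "integral\<^sup>L lborel (power_gauss a c) \<noteq> 0"
  proof
    assume "integral\<^sup>L lborel (power_gauss a c) = 0"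
    hence "AE x in lborel. power_gauss a c x = 0"
      by (subst (asm) integral_nonneg_eq_0_iff_AE[OF integrable_power_gauss[OF assms]])
         (auto simp: power_gauss_nonneg)
    hence "AE x in lborel. x \<notin> {0<..<1::real}"
      by eventually_elim (auto simp: power_gauss_def)
    hence "emeasure lborel {0<..<1::real} = 0"
      by (subst (asm) AE_iff_measurable[where N = "{0<..<1}"]) auto
    thus False by simp
  qed
  moreover have "0 \<le> integral\<^sup>L lborel (power_gauss a c)"
    by (intro integral_nonneg_AE AE_I2 power_gauss_nonneg)
  ultimately show ?thesis by simp
qed

text \<open>Scaling turns a shift of the rate, which is what weighting by
  \<open>exp (- s * x\<^sup>2)\<close> causes, into a Gamma transform of shape
  \<open>(a + 1) / 2\<close>. Hence a shape \<open>p\<close> will correspond to the exponent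
  \<open>2 * p - 1\<close>.\<close>

lemma integral_power_gauss_shift:
  assumes "- 1 < a" "0 < c" "0 < s"
  shows "integral\<^sup>L lborel (power_gauss a (c + s))
    = integral\<^sup>L lborel (power_gauss a c) * (c / (c + s)) powr ((a + 1) / 2)"
proof -
  have "(c + s) powr (- (a + 1) / 2) = c powr (- (a + 1) / 2) * (c / (c + s)) powr ((a + 1) / 2)"
    using assms by (simp add: powr_divide powr_minus minus_divide_left[symmetric] field_simps del: minus_add_distrib)
  thus ?thesis
    using assms integral_power_gauss_scale[of c a] integral_power_gauss_scale[of "c + s" a] by simp
qed

lemma lborel_integral_uminus:
  fixes f :: "real \<Rightarrow> real"
  shows "(LINT x|lborel. f (- x)) = integral\<^sup>L lborel f"
  using lborel_integral_real_affine[of "- 1" f 0] by simp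

lemma lborel_integrable_uminus:
  fixes f :: "real \<Rightarrow> real"
  shows "integrable lborel f \<Longrightarrow> integrable lborel (\<lambda>x. f (- x))"
  using lborel_integrable_real_affine[of f "- 1" 0] by simp

lemma qg_integral_eq:
  assumes "0 < \<gamma>"
  shows "qg_integral a (1 / sqrt (2 * \<gamma>)) = integral\<^sup>L lborel (power_gauss a \<gamma>)"
proof -
  have "- x\<^sup>2 / (2 * (1 / sqrt (2 * \<gamma>))\<^sup>2) = - \<gamma> * x\<^sup>2" for x
    using assms by (simp add: power_divide field_simps)
  thus ?thesis
    by (simp only: qg_integral_def set_lebesgue_integral_def power_gauss_def[abs_def]
          real_scaleR_def)
qed

text \<open>\<open>\<sigma>\<close> solves \<open>1 / (2 * \<sigma>\<^sup>2) = \<gamma>\<close>, and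
  the factor \<open>\<sigma> * sqrt (2 * pi)\<close> in the constants cancels the normalization of
  the normal density.\<close>

lemma qg_density_eq:
  assumes "0 < \<gamma>"
  defines "\<sigma> \<equiv> 1 / sqrt (2 * \<gamma>)"
  shows "qg_density (a1, a2) \<sigma> (\<sigma> * sqrt (2 * pi) * A1) (\<sigma> * sqrt (2 * pi) * A2) x
    = A1 * power_gauss a1 \<gamma> (- x) + A2 * power_gauss a2 \<gamma> x"
proof -
  have "\<sigma> > 0" using assms by (simp add: \<sigma>_def)
  have \<sigma>2: "2 * \<sigma>\<^sup>2 = 1 / \<gamma>"
    using assms(1) unfolding \<sigma>_def by (simp add: power_divide)
  have "sqrt (2 * pi * \<sigma>\<^sup>2) = \<sigma> * sqrt (2 * pi)"
    using \<open>\<sigma> > 0\<close> by (simp add: real_sqrt_mult)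
  hence n: "normal_density 0 \<sigma> x = exp (- \<gamma> * x\<^sup>2) / (\<sigma> * sqrt (2 * pi))"
    unfolding normal_density_def \<sigma>2 by (simp add: mult_ac)
  show ?thesis
    unfolding qg_density_def qg_weight_def n power_gauss_def using \<open>\<sigma> > 0\<close>
    by (auto simp: indicator_def)
qed

text \<open>A candidate density is built with the prescribed transforms on both sides, and
  uniqueness identifies it with the law.\<close>

lemma quasi_gaussian_of_half_laplace:
  assumes N: "real_distribution N"
    and par: "0 < \<gamma>" "0 < p" "0 < q" "0 \<le> P" "0 \<le> Q" "P + Q = 1"
    and neg: "\<And>s. 0 < s \<Longrightarrow> half_laplace N (- 1) 0 s = P * (\<gamma> / (\<gamma> + s)) powr p"
    and pos: "\<And>s. 0 < s \<Longrightarrow> half_laplace N 1 0 s = Q * (\<gamma> / (\<gamma> + s)) powr q"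
  shows "\<exists>C1\<ge>0. \<exists>C2\<ge>0. qg_admissible (2 * p - 1, 2 * q - 1) (1 / sqrt (2 * \<gamma>)) C1 C2 \<and>
    N = density lborel (\<lambda>x. ennreal (qg_density (2 * p - 1, 2 * q - 1) (1 / sqrt (2 * \<gamma>)) C1 C2 x))"
proof -
  define a b \<sigma> where "a = 2 * p - 1" and "b = 2 * q - 1" and "\<sigma> = 1 / sqrt (2 * \<gamma>)"
  have ab: "- 1 < a" "- 1 < b" and \<sigma>: "0 < \<sigma>"
    using par by (simp_all add: a_def b_def \<sigma>_def)
  define J where "J a = integral\<^sup>L lborel (power_gauss a \<gamma>)" for a
  have J: "0 < J a" "0 < J b"
    unfolding J_def using ab par by (auto intro: integral_power_gauss_pos)
  \<comment> \<open>These weights give the negative half-line mass \<open>P\<close> and the positive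
    one mass \<open>Q\<close>; with \<open>P + Q = 1\<close> the total is \<open>1\<close>.\<close>
  define A B where "A = P / J a" and "B = Q / J b"
  have AB: "0 \<le> A" "0 \<le> B" "A * J a = P" "B * J b = Q"
    using par J by (auto simp: A_def B_def)
  define f where "f = qg_density (a, b) \<sigma> (\<sigma> * sqrt (2 * pi) * A) (\<sigma> * sqrt (2 * pi) * B)"
  have f: "f = (\<lambda>x. A * power_gauss a \<gamma> (- x) + B * power_gauss b \<gamma> x)"
    unfolding f_def \<sigma>_def using par by (intro ext qg_density_eq)
  have [measurable]: "f \<in> borel_measurable borel"
    unfolding f by measurable
  have f_nonneg: "0 \<le> f x" for x
    unfolding f using AB by (simp add: power_gauss_nonneg)
  have int_a: "integrable lborel (\<lambda>x. A * power_gauss a \<gamma> (- x))"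
    and int_b: "integrable lborel (\<lambda>x. B * power_gauss b \<gamma> x)"
    using ab par
    by (intro integrable_mult_right lborel_integrable_uminus integrable_power_gauss; simp)+
  have "integral\<^sup>L lborel f = 1"
    unfolding f Bochner_Integration.integral_add[OF int_a int_b]
    using AB par by (simp add: lborel_integral_uminus J_def)
  moreover have "integrable lborel f"
    unfolding f by (intro Bochner_Integration.integrable_add int_a int_b)
  ultimately have "(\<integral>\<^sup>+x. ennreal (f x) \<partial>lborel) = 1"
    using f_nonneg by (subst nn_integral_eq_integral) auto
  hence "prob_space (density lborel (\<lambda>x. ennreal (f x)))"
    by (intro prob_spaceI) (simp add: emeasure_density)
  hence D: "real_distribution (density lborel (\<lambda>x. ennreal (f x)))"
    by (simp add: real_distribution_def real_distribution_axioms_def)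
  have hl: "half_laplace (density lborel (\<lambda>x. ennreal (f x))) e 0 s
      = (LINT x|lborel. f x * (indicator {0<..} (e * x) * exp (- s * x\<^sup>2)))" for e s
    unfolding half_laplace_def using f_nonneg by (subst integral_real_density) auto
  have "half_laplace N e 0 s = half_laplace (density lborel (\<lambda>x. ennreal (f x))) e 0 s"
    if "e \<in> {1, - 1}" and s: "0 < s" for e s
  proof (cases "e = 1")
    case True
    have "f x * (indicator {0<..} (e * x) * exp (- s * x\<^sup>2)) = B * power_gauss b (\<gamma> + s) x" for x
      unfolding f power_gauss_def True by (auto simp: indicator_def algebra_simps simp flip: exp_add)
    hence "half_laplace (density lborel (\<lambda>x. ennreal (f x))) e 0 s
        = B * integral\<^sup>L lborel (power_gauss b (\<gamma> + s))"
      unfolding hl by simp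
    also have "\<dots> = (B * J b) * (\<gamma> / (\<gamma> + s)) powr q"
      using ab par s by (simp add: integral_power_gauss_shift J_def b_def)
    finally show ?thesis
      using pos[OF s] AB True by simp
  next
    case False
    with that have e: "e = - 1" by simp
    have "f x * (indicator {0<..} (e * x) * exp (- s * x\<^sup>2)) = A * power_gauss a (\<gamma> + s) (- x)" for x
      unfolding f power_gauss_def e by (auto simp: indicator_def algebra_simps simp flip: exp_add)
    hence "half_laplace (density lborel (\<lambda>x. ennreal (f x))) e 0 s
        = A * integral\<^sup>L lborel (power_gauss a (\<gamma> + s))"
      unfolding hl by (simp add: lborel_integral_uminus)
    also have "\<dots> = (A * J a) * (\<gamma> / (\<gamma> + s)) powr p"
      using ab par s by (simp add: integral_power_gauss_shift J_def a_def)
    finally show ?thesis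
      using neg[OF s] AB e by simp
  qed
  hence "N = density lborel (\<lambda>x. ennreal (f x))"
    by (intro real_distribution_eqI_half_laplace N D)
  moreover have "qg_admissible (a, b) \<sigma> (\<sigma> * sqrt (2 * pi) * A) (\<sigma> * sqrt (2 * pi) * B)"
  proof -
    have "\<sigma> * sqrt (2 * pi) * A * J a + \<sigma> * sqrt (2 * pi) * B * J b
        = \<sigma> * sqrt (2 * pi) * (A * J a + B * J b)"
      by (simp add: algebra_simps)
    thus ?thesis
      using ab \<sigma> AB par unfolding qg_admissible_def
      by (simp add: \<sigma>_def qg_integral_eq J_def)
  qed
  moreover have "0 \<le> \<sigma> * sqrt (2 * pi) * A" "0 \<le> \<sigma> * sqrt (2 * pi) * B"
    using \<sigma> AB by simp_all
  ultimately show ?thesis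
    unfolding f_def a_def b_def \<sigma>_def by blast
qed

subsection \<open>Independence of the polar coordinates\<close>

lemma (in prob_space) half_laplace_distr:
  assumes [measurable]: "random_variable borel X"
  shows "half_laplace (distr M borel X) e k s
    = expectation (\<lambda>\<omega>. indicator {0<..} (e * X \<omega>) * ((X \<omega>)\<^sup>2) ^ k * exp (- s * (X \<omega>)\<^sup>2))"
  unfolding half_laplace_def by (subst integral_distr) auto

text \<open>The signs depend on the angle alone, the exponential on the radius alone, and the powers
  split with radial degree \<open>j + k\<close>.\<close>

lemma polar_product:
  fixes x y e e' s :: real
  defines "\<rho> \<equiv> sqrt (x\<^sup>2 + y\<^sup>2)" and "\<theta> \<equiv> Arg2pi (Complex x y)"
  shows "(indicator {0<..} (e * x) * (x\<^sup>2) ^ j * exp (- s * x\<^sup>2)) *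
      (indicator {0<..} (e' * y) * (y\<^sup>2) ^ k * exp (- s * y\<^sup>2))
    = ((\<rho>\<^sup>2) ^ (j + k) * exp (- s * \<rho>\<^sup>2)) *
      (indicator {0<..} (e * cos \<theta>) * indicator {0<..} (e' * sin \<theta>) *
        ((cos \<theta>)\<^sup>2) ^ j * ((sin \<theta>)\<^sup>2) ^ k)"
proof (cases "\<rho> = 0")
  case True
  \<comment> \<open>At the origin both sides vanish: the indicators exclude \<open>0\<close>, and
    \<open>Arg2pi 0 = 0\<close> makes the sine zero. So the identity holds without an exceptional
    null set.\<close>
  hence "x = 0" "y = 0"
    by (simp_all add: \<rho>_def sum_power2_eq_zero_iff)
  moreover have "Complex 0 0 = 0"
    by (simp add: complex_eq_iff)
  ultimately have "x = 0" "y = 0" "\<theta> = 0"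
    by (simp_all add: \<theta>_def)
  thus ?thesis by simp
next
  case False
  hence "0 < \<rho>" by (simp add: \<rho>_def order_le_neq_trans)
  have xy: "x = \<rho> * cos \<theta>" "y = \<rho> * sin \<theta>"
    using cos_Arg2pi[of "Complex x y"] sin_Arg2pi[of "Complex x y"]
    by (simp_all add: \<rho>_def \<theta>_def cmod_def)
  have sq: "x\<^sup>2 + y\<^sup>2 = \<rho>\<^sup>2"
    by (simp add: \<rho>_def)
  have exp: "exp (- s * x\<^sup>2) * exp (- s * y\<^sup>2) = exp (- s * \<rho>\<^sup>2)"
    unfolding sq[symmetric] by (simp add: algebra_simps flip: exp_add)
  have ind: "indicator {0<..} (e * x) = (indicator {0<..} (e * cos \<theta>) :: real)"
    "indicator {0<..} (e' * y) = (indicator {0<..} (e' * sin \<theta>) :: real)"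
    using \<open>0 < \<rho>\<close> unfolding xy by (auto simp: indicator_def zero_less_mult_iff mult_less_0_iff)
  have pow: "(x\<^sup>2) ^ j * (y\<^sup>2) ^ k = (\<rho>\<^sup>2) ^ (j + k) * ((cos \<theta>)\<^sup>2) ^ j * ((sin \<theta>)\<^sup>2) ^ k"
    unfolding xy by (simp add: power_mult_distrib power_add)
  have "(indicator {0<..} (e * x) * (x\<^sup>2) ^ j * exp (- s * x\<^sup>2)) *
      (indicator {0<..} (e' * y) * (y\<^sup>2) ^ k * exp (- s * y\<^sup>2))
    = (indicator {0<..} (e * x) * indicator {0<..} (e' * y)) * ((x\<^sup>2) ^ j * (y\<^sup>2) ^ k) *
      (exp (- s * x\<^sup>2) * exp (- s * y\<^sup>2))"
    by (simp only: mult_ac)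
  also have "\<dots> = ((\<rho>\<^sup>2) ^ (j + k) * exp (- s * \<rho>\<^sup>2)) *
      (indicator {0<..} (e * cos \<theta>) * indicator {0<..} (e' * sin \<theta>) *
        ((cos \<theta>)\<^sup>2) ^ j * ((sin \<theta>)\<^sup>2) ^ k)"
    unfolding exp ind pow by (simp only: mult_ac)
  finally show ?thesis .
qed

text \<open>The expectation of one product is factored twice, by independence of \<open>X\<close>
  and \<open>Y\<close> and, after \<open>polar_product\<close>, by independence of radius and angle.
  The witness \<open>c\<close> is the angular expectation and \<open>n\<close> the radial
  one.\<close>

lemma (in prob_space) half_laplace_product:
  assumes indep: "indep_var borel X borel Y"
    and polar: "indep_var borel (\<lambda>\<omega>. sqrt ((X \<omega>)\<^sup>2 + (Y \<omega>)\<^sup>2))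
                  borel (\<lambda>\<omega>. Arg2pi (Complex (X \<omega>) (Y \<omega>)))"
  shows "\<exists>c n. \<forall>j k. \<forall>s>0. half_laplace (distr M borel X) e j s * half_laplace (distr M borel Y) e' k s
    = c j k * n (j + k) s"
proof -
  have X [measurable]: "random_variable borel X" and Y [measurable]: "random_variable borel Y"
    using indep by (auto simp: indep_var_eq)
  define \<rho> where "\<rho> \<omega> = sqrt ((X \<omega>)\<^sup>2 + (Y \<omega>)\<^sup>2)" for \<omega>
  define \<theta> where "\<theta> \<omega> = Arg2pi (Complex (X \<omega>) (Y \<omega>))" for \<omega>
  have polar': "indep_var borel \<rho> borel \<theta>"
    using polar unfolding \<rho>_def \<theta>_def .
  have \<rho> [measurable]: "random_variable borel \<rho>" and \<theta> [measurable]: "random_variable borel \<theta>"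
    using polar' by (auto simp: indep_var_eq)
  let ?h = "\<lambda>e k s (x::real). indicator {0<..} (e * x) * (x\<^sup>2) ^ k * exp (- s * x\<^sup>2) :: real"
  let ?n = "\<lambda>k s (r::real). (r\<^sup>2) ^ k * exp (- s * r\<^sup>2)"
  let ?c = "\<lambda>j k (t::real). indicator {0<..} (e * cos t) * indicator {0<..} (e' * sin t) *
        ((cos t)\<^sup>2) ^ j * ((sin t)\<^sup>2) ^ k :: real"
  have bound: "\<bar>?n k s r\<bar> \<le> fact k / s ^ k" if "0 < s" for k and s r :: real
    using power_mult_exp_le[of "r\<^sup>2" s k] that by simp
  have "half_laplace (distr M borel X) e j s * half_laplace (distr M borel Y) e' k s
      = expectation (\<lambda>\<omega>. ?c j k (\<theta> \<omega>)) * expectation (\<lambda>\<omega>. ?n (j + k) s (\<rho> \<omega>))"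
    if s: "0 < s" for j k s
  proof -
    have int_h: "integrable M (\<lambda>\<omega>. ?h e k s (Z \<omega>))"
      if [measurable]: "random_variable borel Z" for Z e k
      using bound[OF s] s
      by (intro integrable_const_bound[where B = "fact k / s ^ k"] AE_I2) (auto simp: indicator_def)
    have "half_laplace (distr M borel X) e j s * half_laplace (distr M borel Y) e' k s
        = expectation (\<lambda>\<omega>. ?h e j s (X \<omega>)) * expectation (\<lambda>\<omega>. ?h e' k s (Y \<omega>))"
      by (simp only: half_laplace_distr X Y)
    also have "\<dots> = expectation (\<lambda>\<omega>. ?h e j s (X \<omega>) * ?h e' k s (Y \<omega>))"
      using indep_var_compose[OF indep, of "?h e j s" borel "?h e' k s" borel]
      by (intro indep_var_lebesgue_integral[symmetric] int_h X Y) (simp add: comp_def)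
    also have "\<dots> = expectation (\<lambda>\<omega>. ?n (j + k) s (\<rho> \<omega>) * ?c j k (\<theta> \<omega>))"
      unfolding polar_product \<rho>_def \<theta>_def ..
    also have "\<dots> = expectation (\<lambda>\<omega>. ?n (j + k) s (\<rho> \<omega>)) * expectation (\<lambda>\<omega>. ?c j k (\<theta> \<omega>))"
    proof (rule indep_var_lebesgue_integral)
      show "indep_var borel (\<lambda>\<omega>. ?n (j + k) s (\<rho> \<omega>)) borel (\<lambda>\<omega>. ?c j k (\<theta> \<omega>))"
        using indep_var_compose[OF polar', of "?n (j + k) s" borel "?c j k" borel]
        by (simp add: comp_def)
      show "integrable M (\<lambda>\<omega>. ?n (j + k) s (\<rho> \<omega>))"
        using bound[OF s] s
        by (intro integrable_const_bound[where B = "fact (j + k) / s ^ (j + k)"] AE_I2) auto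
      have "((cos t)\<^sup>2) ^ j * ((sin t)\<^sup>2) ^ k \<le> 1" for t :: real
        by (rule mult_le_one[OF power_le_one[OF zero_le_power2]
              zero_le_power[OF zero_le_power2] power_le_one[OF zero_le_power2]])
           (simp_all add: abs_square_le_1)
      hence "\<bar>?c j k t\<bar> \<le> 1" for t
        by (auto simp: indicator_def)
      thus "integrable M (\<lambda>\<omega>. ?c j k (\<theta> \<omega>))"
        by (intro integrable_const_bound[where B = 1] AE_I2) auto
    qed
    finally show ?thesis by (simp only: mult.commute)
  qed
  thus ?thesis
    by (intro exI[of _ "\<lambda>j k. expectation (\<lambda>\<omega>. ?c j k (\<theta> \<omega>))"]
          exI[of _ "\<lambda>k s. expectation (\<lambda>\<omega>. ?n k s (\<rho> \<omega>))"]) blast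
qed

text \<open>Comparing indices with the same sum \<open>j + k\<close> eliminates the radial factor \<open>n\<close>.\<close>

lemma product_form_relations:
  fixes f g :: "nat \<Rightarrow> real \<Rightarrow> real"
  assumes pos: "\<And>j s. 0 < s \<Longrightarrow> 0 < f j s" "\<And>k s. 0 < s \<Longrightarrow> 0 < g k s"
    and prod: "\<And>j k s. 0 < s \<Longrightarrow> f j s * g k s = c j k * n (j + k) s"
  shows "\<exists>r>0. \<forall>s>0. f 0 s * g 1 s = r * f 1 s * g 0 s"
    and "\<exists>K. \<forall>s>0. f 0 s * f 2 s = K * (f 1 s)\<^sup>2"
proof -
  \<comment> \<open>The left side of \<open>prod\<close> is positive, so no constant vanishes and
    the quotients below are legitimate.\<close>
  have c: "c j k \<noteq> 0" for j k
    using prod[of 1 j k] pos(1)[of 1 j] pos(2)[of 1 k] by auto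
  define r where "r = c 0 1 / c 1 0"
  have r: "f 0 s * g 1 s = r * f 1 s * g 0 s" if "0 < s" for s
    using prod[OF that, of 0 1] prod[OF that, of 1 0] c[of 1 0] by (simp add: r_def field_simps)
  have "0 < f 0 1 * g 1 1"
    by (intro mult_pos_pos pos) auto
  also have "\<dots> = r * (f 1 1 * g 0 1)"
    using r[of 1] by simp
  finally have "0 < r"
    by (rule zero_less_mult_pos2) (intro mult_pos_pos pos; simp)
  with r show "\<exists>r>0. \<forall>s>0. f 0 s * g 1 s = r * f 1 s * g 0 s" by blast
  \<comment> \<open>The index pairs \<open>(1, 1)\<close> and \<open>(2, 0)\<close> share the sum
    \<open>2\<close>. Trading \<open>g 1\<close> for \<open>g 0\<close> by \<open>r\<close> and
    cancelling \<open>g 0\<close> leaves a relation in \<open>f\<close> alone.\<close>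
  have "f 0 s * f 2 s = (r * c 2 0 / c 1 1) * (f 1 s)\<^sup>2" if s: "0 < s" for s
  proof -
    have "f 1 s * g 1 s = c 1 1 / c 2 0 * (f 2 s * g 0 s)"
      using prod[OF s, of 1 1] prod[OF s, of 2 0] c[of 2 0] by (simp add: numeral_2_eq_2)
    hence "f 0 s * (f 2 s * g 0 s) = c 2 0 / c 1 1 * (f 1 s * (f 0 s * g 1 s))"
      using c[of 2 0] c[of 1 1] by (simp add: field_simps)
    also have "\<dots> = (r * c 2 0 / c 1 1) * (f 1 s)\<^sup>2 * g 0 s"
      unfolding r[OF s] by (simp add: power2_eq_square)
    finally have "(f 0 s * f 2 s) * g 0 s = ((r * c 2 0 / c 1 1) * (f 1 s)\<^sup>2) * g 0 s"
      by (simp only: mult.assoc)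
    thus ?thesis
      using pos(2)[OF s, of 0] by (subst (asm) mult_right_cancel) auto
  qed
  thus "\<exists>K. \<forall>s>0. f 0 s * f 2 s = K * (f 1 s)\<^sup>2" by blast
qed

section \<open>Consequences of regularity\<close>

lemma regular_distribution_no_atoms:
  assumes "regular_distribution M X"
  shows "AE x in distr M borel X. x \<noteq> y"
proof -
  obtain f where f: "distributed M lborel X (\<lambda>x. ennreal (f x))"
    using assms(1) by (auto simp: regular_distribution_def)
  have "AE x in density lborel (\<lambda>x. ennreal (f x)). x \<noteq> y"
    using distributed_borel_measurable[OF f] AE_lborel_singleton[of y]
    by (subst AE_density) (auto elim: eventually_mono)
  \<comment> \<open>\<open>distributed\<close> refers to \<open>lborel\<close>, the transforms to
    \<open>borel\<close>; the image measure is the same because the measurable sets agree.\<close>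
  moreover have "distr M borel X = density lborel (\<lambda>x. ennreal (f x))"
    using distributed_distr_eq_density[OF f] distr_cong[of M M lborel borel X X] by simp
  ultimately show ?thesis
    by (simp only:)
qed

text \<open>The positive infimum makes the density positive at every point of \<open>(-1, 1)\<close>
  other than \<open>0\<close>. If a side had probability zero, an interval of length
  \<open>1\<close> on that side would be a Lebesgue null set.\<close>

lemma regular_distribution_sides:
  assumes "regular_distribution M X" and e: "e \<in> {1, - 1}"
  shows "\<not> (AE x in distr M borel X. \<not> 0 < e * x)"
proof
  assume "AE x in distr M borel X. \<not> 0 < e * x"
  obtain f \<mu> where f: "distributed M lborel X (\<lambda>x. ennreal (f x))" and \<mu>: "regular_degree f \<mu>"
    using assms(1) by (auto simp: regular_distribution_def)
  have f_pos: "0 < f x" if "x \<in> {- 1<..<1} - {0}" for x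
  proof -
    have "0 < ereal (f x / \<bar>x\<bar> powr \<mu>)"
      using \<mu> that unfolding regular_degree_def by (blast intro: INF_lower less_le_trans)
    thus ?thesis
      using that by (simp add: zero_less_divide_iff)
  qed
  have "distr M borel X = density lborel (\<lambda>x. ennreal (f x))"
    using distributed_distr_eq_density[OF f] distr_cong[of M M lborel borel X X] by simp
  with \<open>AE x in distr M borel X. \<not> 0 < e * x\<close>
  have "AE x in density lborel (\<lambda>x. ennreal (f x)). \<not> 0 < e * x"
    by (simp only:)
  hence "AE x in lborel. 0 < ennreal (f x) \<longrightarrow> \<not> 0 < e * x"
    using distributed_borel_measurable[OF f] by (subst (asm) AE_density) auto
  hence "AE x in lborel. x \<notin> (if e = 1 then {0<..<1} else {- 1<..<0::real})"
    by (rule eventually_mono) (use e f_pos in \<open>auto split: if_splits\<close>)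
  hence "emeasure lborel (if e = 1 then {0<..<1} else {- 1<..<0::real}) = 0"
    by (subst (asm) AE_iff_measurable[where N = "if e = 1 then {0<..<1} else {- 1<..<0}"]) auto
  thus False by (simp split: if_splits)
qed

section \<open>From transforms to the laws\<close>

lemma (in real_distribution) prob_sides:
  assumes "AE x in M. x \<noteq> 0"
  shows "prob {x. 0 < - 1 * x} + prob {x. 0 < 1 * x} = 1"
proof -
  have "prob {x. 0 < - 1 * x} + prob {x. 0 < 1 * x} = prob ({x. 0 < - 1 * x} \<union> {x. 0 < 1 * x})"
    by (rule finite_measure_Union[symmetric]) auto
  also have "\<dots> = 1"
    using assms by (subst prob_eq_1) (auto elim: eventually_mono)
  finally show ?thesis .
qed

text \<open>The shape \<open>p (- 1)\<close> enters the first exponent, which governs the negative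
  half-line. The quasi-standard depends on \<open>\<gamma>\<close> alone, so a common rate yields a
  common quasi-standard.\<close>

lemma has_law_QN_of_half_laplace:
  assumes M: "prob_space M" and X: "X \<in> borel_measurable M"
    and no_atoms: "AE x in distr M borel X. x \<noteq> 0"
    and \<gamma>: "0 < \<gamma>" and p: "\<And>e. e \<in> {1, - 1} \<Longrightarrow> 0 < p e"
    and hl: "\<And>e s. e \<in> {1, - 1} \<Longrightarrow> 0 < s \<Longrightarrow> half_laplace (distr M borel X) e 0 s
               = measure (distr M borel X) {x. 0 < e * x} * (\<gamma> / (\<gamma> + s)) powr p e"
  shows "\<exists>\<alpha> C1 C2. has_law_QN M X 0 \<alpha> (1 / sqrt (2 * \<gamma>)) C1 C2"
proof -
  interpret prob_space M by fact
  interpret N: real_distribution "distr M borel X" using X by (rule real_distribution_distr)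
  obtain C1 C2 where C: "qg_admissible (2 * p (- 1) - 1, 2 * p 1 - 1) (1 / sqrt (2 * \<gamma>)) C1 C2"
    "distr M borel X = density lborel
      (\<lambda>x. ennreal (qg_density (2 * p (- 1) - 1, 2 * p 1 - 1) (1 / sqrt (2 * \<gamma>)) C1 C2 x))"
    using quasi_gaussian_of_half_laplace[OF N.real_distribution_axioms \<gamma> p p
        measure_nonneg measure_nonneg N.prob_sides[OF no_atoms] hl hl] by auto
  have "(\<lambda>x. qg_density \<alpha> \<sigma> C1 C2 x) \<in> borel_measurable borel" for \<alpha> \<sigma>
    unfolding qg_density_def qg_weight_def by measurable
  moreover have "distr M lborel X = distr M borel X"
    by (rule distr_cong) auto
  ultimately have "has_law_QN M X 0 (2 * p (- 1) - 1, 2 * p 1 - 1) (1 / sqrt (2 * \<gamma>)) C1 C2"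
    using C X unfolding has_law_QN_def distributed_def by simp
  thus ?thesis by blast
qed

theorem mainTheorem1:
  fixes M :: "'a measure" and \<xi> \<eta> :: "'a \<Rightarrow> real"
  assumes "prob_space M"
    and "prob_space.indep_var M borel \<xi> borel \<eta>"
    and "regular_distribution M \<xi>"
    and "regular_distribution M \<eta>"
    and "prob_space.indep_var M
           borel (\<lambda>\<omega>. sqrt ((\<xi> \<omega>)\<^sup>2 + (\<eta> \<omega>)\<^sup>2))
           borel (\<lambda>\<omega>. Arg2pi (Complex (\<xi> \<omega>) (\<eta> \<omega>)))"
  shows "\<exists>\<sigma> (\<alpha> :: real \<times> real) (\<beta> :: real \<times> real) C1 C2 C3 C4.
           \<sigma> > 0 \<and>
           fst \<alpha> > -1 \<and> snd \<alpha> > -1 \<and> fst \<beta> > -1 \<and> snd \<beta> > -1 \<and>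
           C1 \<ge> 0 \<and> C2 \<ge> 0 \<and> C3 \<ge> 0 \<and> C4 \<ge> 0 \<and>
           has_law_QN M \<xi> 0 \<alpha> \<sigma> C1 C2 \<and>
           has_law_QN M \<eta> 0 \<beta> \<sigma> C3 C4"
proof -
  interpret prob_space M by fact
  note indep = assms(2) and regular = assms(3,4) and polar = assms(5)
  have rv: "random_variable borel \<xi>" "random_variable borel \<eta>"
    using indep by (auto simp: indep_var_eq)
  define F where "F = half_laplace (distr M borel \<xi>)"
  define G where "G = half_laplace (distr M borel \<eta>)"
  define P where "P e = measure (distr M borel \<xi>) {x. 0 < e * x}" for e
  define Q where "Q e = measure (distr M borel \<eta>) {x. 0 < e * x}" for e
  interpret F: real_distribution "distr M borel \<xi>" using rv(1) by (rule real_distribution_distr)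
  interpret G: real_distribution "distr M borel \<eta>" using rv(2) by (rule real_distribution_distr)
  note no_atoms = regular_distribution_no_atoms[OF regular(1)]
    regular_distribution_no_atoms[OF regular(2)]
  have F_pos: "0 < F e k s" and G_pos: "0 < G e k s" if "e \<in> {1, - 1}" "0 < s" for e k s
    unfolding F_def G_def using that
    by (auto intro!: F.half_laplace_pos G.half_laplace_pos
        regular_distribution_sides[OF regular(1)] regular_distribution_sides[OF regular(2)])
  have dF: "(F e k has_real_derivative - F e (Suc k) s) (at s)"
    and dG: "(G e k has_real_derivative - G e (Suc k) s) (at s)" if "0 < s" for e k s
    unfolding F_def G_def
    by (rule F.half_laplace_has_derivative[OF that] G.half_laplace_has_derivative[OF that])+
  have limF: "(\<lambda>n. F e 0 (1 / Suc n)) \<longlonglongrightarrow> P e" and limG: "(\<lambda>n. G e 0 (1 / Suc n)) \<longlonglongrightarrow> Q e" for e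
    unfolding F_def G_def P_def Q_def
    by (rule F.half_laplace_tendsto_at_0 G.half_laplace_tendsto_at_0)+
  have rel: "\<exists>r>0. \<forall>s>0. F e 0 s * G e' 1 s = r * F e 1 s * G e' 0 s"
    and ode: "\<exists>K. \<forall>s>0. F e 0 s * F e 2 s = K * (F e 1 s)\<^sup>2"
    if "e \<in> {1, - 1}" "e' \<in> {1, - 1}" for e e'
  proof -
    obtain c n where "\<And>j k s. 0 < s \<Longrightarrow> F e j s * G e' k s = c j k * n (j + k) s"
      using half_laplace_product[OF indep polar, of e e'] unfolding F_def G_def by blast
    from product_form_relations[where f = "F e" and g = "G e'" and c = c and n = n,
        OF F_pos[OF that(1)] G_pos[OF that(2)] this]
    show "\<exists>r>0. \<forall>s>0. F e 0 s * G e' 1 s = r * F e 1 s * G e' 0 s"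
      and "\<exists>K. \<forall>s>0. F e 0 s * F e 2 s = K * (F e 1 s)\<^sup>2" by blast+
  qed

  \<comment> \<open>The differential equation is solved for one side, the positive one of
    \<open>\<xi>\<close>; this supplies the rate \<open>\<gamma>\<close>.\<close>
  obtain K where K: "\<And>s. 0 < s \<Longrightarrow> F 1 0 s * F 1 2 s = K * (F 1 1 s)\<^sup>2"
    using ode[of 1 1] by auto
  have "\<exists>\<gamma> p. 0 < \<gamma> \<and> 0 < p \<and> (\<forall>s>0. F 1 0 s = P 1 * (\<gamma> / (\<gamma> + s)) powr p)"
  proof (rule gamma_transform_of_ode[OF _ _ _ _ K])
    fix s :: real assume s: "0 < s"
    show "(F 1 1 s)\<^sup>2 < F 1 0 s * F 1 2 s"
      unfolding F_def
      by (intro F.half_laplace_strict_log_convex s no_atoms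
          regular_distribution_sides[OF regular(1)]) simp
    show "(F 1 0 has_real_derivative - F 1 1 s) (at s)" "(F 1 1 has_real_derivative - F 1 2 s) (at s)"
      using dF[OF s, of 1 0] dF[OF s, of 1 1] by (simp_all add: numeral_2_eq_2)
  next
    show "(\<lambda>n. F 1 0 (1 / Suc n)) \<longlonglongrightarrow> P 1" by (rule limF)
  qed (auto intro: F_pos)
  then obtain \<gamma> p1 where \<gamma>: "0 < \<gamma>" and p1: "0 < p1"
    "\<And>s. 0 < s \<Longrightarrow> F 1 0 s = P 1 * (\<gamma> / (\<gamma> + s)) powr p1" by blast

  \<comment> \<open>Both sides of \<open>\<eta>\<close> inherit \<open>\<gamma>\<close> from the
    positive side of \<open>\<xi>\<close>.\<close>
  have "\<exists>q>0. \<forall>s>0. G e 0 s = Q e * (\<gamma> / (\<gamma> + s)) powr q" if e: "e \<in> {1, - 1}" for e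
  proof -
    obtain r where r: "0 < r" "\<And>s. 0 < s \<Longrightarrow> F 1 0 s * G e 1 s = r * F 1 1 s * G e 0 s"
      using rel[of 1 e] e by auto
    show ?thesis
      by (rule gamma_transform_transfer[OF _ _ _ _ r(2) p1(2) \<gamma> p1(1) r(1) limG])
         (use e dF[of _ 1 0] dG[of _ e 0] in \<open>auto intro: F_pos G_pos\<close>)
  qed
  then obtain q where q: "\<And>e. e \<in> {1, - 1} \<Longrightarrow> 0 < q e"
    "\<And>e s. e \<in> {1, - 1} \<Longrightarrow> 0 < s \<Longrightarrow> G e 0 s = Q e * (\<gamma> / (\<gamma> + s)) powr q e"
    by metis

  \<comment> \<open>The positive side of \<open>\<eta>\<close> hands \<open>\<gamma>\<close> back to
    both sides of \<open>\<xi>\<close>, which reaches the negative one. The roles in the relation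
    are exchanged, hence \<open>1 / r\<close>.\<close>
  have "\<exists>p>0. \<forall>s>0. F e 0 s = P e * (\<gamma> / (\<gamma> + s)) powr p" if e: "e \<in> {1, - 1}" for e
  proof -
    obtain r where r: "0 < r" "\<And>s. 0 < s \<Longrightarrow> F e 0 s * G 1 1 s = r * F e 1 s * G 1 0 s"
      using rel[of e 1] e by auto
    have r': "G 1 0 s * F e 1 s = 1 / r * G 1 1 s * F e 0 s" if "0 < s" for s
      using r(2)[OF that] r(1) by (simp add: field_simps)
    show ?thesis
      by (rule gamma_transform_transfer[OF _ _ _ _ r' q(2)[of 1] \<gamma> q(1)[of 1] _ limF])
         (use e r dF[of _ e 0] dG[of _ 1 0] in \<open>auto intro: F_pos G_pos\<close>)
  qed
  then obtain p where p: "\<And>e. e \<in> {1, - 1} \<Longrightarrow> 0 < p e"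
    "\<And>e s. e \<in> {1, - 1} \<Longrightarrow> 0 < s \<Longrightarrow> F e 0 s = P e * (\<gamma> / (\<gamma> + s)) powr p e"
    by metis

  obtain \<alpha> C1 C2 where "has_law_QN M \<xi> 0 \<alpha> (1 / sqrt (2 * \<gamma>)) C1 C2"
    using has_law_QN_of_half_laplace[OF assms(1) rv(1) no_atoms(1) \<gamma>, of p] p
    unfolding F_def P_def by blast
  moreover obtain \<beta> C3 C4 where "has_law_QN M \<eta> 0 \<beta> (1 / sqrt (2 * \<gamma>)) C3 C4"
    using has_law_QN_of_half_laplace[OF assms(1) rv(2) no_atoms(2) \<gamma>, of q] q
    unfolding G_def Q_def by blast
  ultimately show ?thesis
    unfolding has_law_QN_def qg_admissible_def by blast
qed

end
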